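(* Consider a constrained dynamic game $\mathcal{G} = ( \mathcal{N}, \{\Gamma^i\}_{i\in\mathcal{N}}, \{J^i\}_{i\in\mathcal{N}},\{\mathcal{C}_k\}_{k\in\{0,\ldots,T\}},f,x_0 )$ with $N$ agents whose stage-wise and terminal costs are, for every $i\in\mathcal{N}$, $$L^i_k(x_k,u_k)=L^{ii}_k(x^i_k,u^i_k)+\sum_{j=1,\,j\ne i}^{N}c^{ij}_kL^{ij}_k(x^i_k,x^j_k)\quad(0\le k\le T-1),\qquad L^i_T(x_T)=L^{ii}_T(x^i_T)+\sum_{j=1,\,j\ne i}^{N}c^{ij}_TL^{ij}_T(x^i_T,x^j_T),$$ with $c^{ij}_k>0$ for all $i,j\in\mathcal{N}$ and $k\in\{0,1,\ldots,T\}$. Assume that for any two agents $i\ne j$ and every $1\le k\le T-1$, $L^{ij}_k(x^i_k,x^j_k)=L^{ji}_k(x^j_k,x^i_k)$ for all $x^i_k\in\mathcal{X}^i$, $x^j_k\in\mathcal{X}^j$, and likewise $L^{ij}_T(x^i_T,x^j_T)=L^{ji}_T(x^j_T,x^i_T)$ for all $x^i_T\in\mathcal{X}^i$, $x^j_T\in\mathcal{X}^j$. If for every agent $j\in\mathcal{N}$ (and every $k\in\{0,\ldots,T\}$) we have $c^{ij}_k=c^j_k$ for every $i\in\mathcal{N}\setminus\{j\}$, then $\mathcal{G}$ is a WCPDG with weights $w^i_k=\frac{1}{c^i_k}$, $0\le k\le T$, and a corresponding potential function is $P(x,u)=L_T(x_T)+\sum_{k=0}^{T-1}L_k(x_k,u_k)$,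 where $$L_k(x_k,u_k)=\sum_{i=1}^{N}c^i_kL^{ii}_k(x^i_k,u^i_k)+\sum_{i=1}^{N-1}\sum_{j=i+1}^{N}c^i_kc^j_kL^{ij}_k(x^i_k,x^j_k),$$ $$L_T(x_T)=\sum_{i=1}^{N}c^i_TL^{ii}_T(x^i_T)+\sum_{i=1}^{N-1}\sum_{j=i+1}^{N}c^i_Tc^j_TL^{ij}_T(x^i_T,x^j_T).$$
   Context: Setting. $\mathcal{N}=\{1,\ldots,N\}$ is the set of agents and $T$ is a finite horizon. Agent $i$ has state space $\mathcal{X}^i\subseteq\mathbb{R}^{n_i}$ and action space $\mathcal{U}^i\subseteq\mathbb{R}^{m_i}$; $\mathcal{X}=\prod_i\mathcal{X}^i$, $\mathcal{U}=\prod_i\mathcal{U}^i$. The joint state and action at time $k$ are $x_k=(x^1_k,\ldots,x^N_k)$ and $u_k=(u^1_k,\ldots,u^N_k)$; $x=\{x_k\}_{k=0}^{T}$, $u=\{u_k\}_{k=0}^{T-1}$. A superscript $-i$ denotes the tuple of components of all agents except $i$; the superscripts on $c^{ij}_k$, $c^i_k$ and $L^{ij}_k$ are indices, not powers. The initial state $x_0$ is fixed. Each agent has separate dynamics $x^i_{k+1}=f^i(x^i_k,u^i_k)$; jointly $x_{k+1}=f(x_k,u_k)$ with $f=(f^1,\ldots,f^N)$. The shared inequality constraints are $g(x_k,u_k)\le 0$ (elementwise, $g:\mathcal{X}\times\mathcal{U}\to\mathbb{R}^c$) for $0\le k\le T-1$ and $g(x_T)\le 0$ at the terminal time (a function of the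 terminal state only). $\mathcal{C}_k$ is the set of feasible pairs $(x_k,u_k)$ at time $k\le T-1$ (in $\mathcal{X}\times\mathcal{U}$, consistent with the dynamics, satisfying $g(x_k,u_k)\le0$), and $\mathcal{C}_T=\{x_T\in\mathcal{X}: g(x_T)\le 0\}$. Costs. Agent $i$ minimizes $J^i(x,u)=L^i_T(x_T)+\sum_{k=0}^{T-1}L^i_k(x_k,u_k)$. Strategies. An open-loop strategy of agent $i$ is $\gamma^i=\{\gamma^i_k\}_{k=0}^{T-1}$, determined by $x_0$ and time, $u^i_k=\gamma^i(x_0,k)$; for given $x_0$ it is identified with the action sequence of agent $i$. $\Gamma^i$ is the strategy space of agent $i$, $\Gamma=\prod_i\Gamma^i$. A joint strategy $\gamma$ is feasible if the state-action trajectory $(x,u)$ it generates from $x_0$ satisfies $(x_k,u_k)\in\mathcal{C}_k$ for $0\le k\le T-1$ and $x_T\in\mathcal{C}_T$; such $(x,u)$ is called a feasible system trajectory. WCPDG. $\mathcal{G}$ is a weighted constrained potential dynamic game (WCPDG, also called a $w$-potential game) with positive weights $w=(w^i_k)_{i\in\mathcal{N},\,0\le k\le T}$ if there exists a potential functional $P(x,u)=L_T(x_T)+\sum_{k=0}^{T-1}L_k(x_k,u_k)$ such that for every agent $i$, all strategies $\gamma^i,\nu^i\in\Gamma^i$ and $\gamma^{-i}\in\Gamma^{-i}$ with $(\gamma^i,\gamma^{-i})$ and $(\nu^i,\gamma^{-i})$ feasible, $$J^i(x,u)-J^i(x',u')=w^i_T\big(L_T(x_T)-L_T(x'_T)\big)+\sum_{k=0}^{T-1}w^i_k\big(L_k(x_k,u_k)-L_k(x'_k,u'_k)\big),$$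 where $(x,u)$ and $(x',u')$ are the feasible system trajectories generated by $(\gamma^i,\gamma^{-i})$ and $(\nu^i,\gamma^{-i})$, respectively (both starting from $x_0$). Standing assumptions. The costs $L^i_k$ and $L^i_T$ are continuously differentiable on $\mathcal{X}\times\mathcal{U}$ and $\mathcal{X}$, respectively. The dynamics $f$ and constraints $g$ are continuously differentiable on $\mathcal{X}\times\mathcal{U}$ and satisfy some regularity conditions (such as linear independence of gradients or the Mangasarian-Fromovitz constraint qualification). *)

theory Defs
  imports "HOL-Analysis.Analysis"
begin

text \<open>
  The agents \<open>1, \<dots>, N\<close> are the elements of a finite linearly ordered type \<open>'i\<close>, with
  \<open>N = CARD('i)\<close>. The agents may have state spaces of different dimensions: the space of agent
  \<open>i\<close> is a linear subspace \<open>state_ambient i\<close>, of dimension \<open>n_i\<close>, of one common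
  Euclidean space \<open>'x\<close>, which has no other role; likewise for the actions. A joint state
  is then a vector in \<open>('x, 'i) vec\<close>, with the components of agent \<open>i\<close> in \<open>x $ i\<close>.
  Stage \<open>k\<close> costs are only meaningful for \<open>k < horizon\<close>.
\<close>

record ('i, 'x, 'u, 'c, 'd) dynamic_game =
  horizon :: nat
  state_ambient :: "'i \<Rightarrow> 'x set"
  action_ambient :: "'i \<Rightarrow> 'u set"
  state_space :: "'i \<Rightarrow> 'x set"
  action_space :: "'i \<Rightarrow> 'u set"
  dynamics :: "'i \<Rightarrow> 'x \<Rightarrow> 'u \<Rightarrow> 'x"
  init :: "('x, 'i) vec"
  constr :: "('x, 'i) vec \<Rightarrow> ('u, 'i) vec \<Rightarrow> (real, 'c) vec"
  term_constr :: "('x, 'i) vec \<Rightarrow> (real, 'd) vec"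
  strategies :: "'i \<Rightarrow> (nat \<Rightarrow> 'u) set"
  stage_cost :: "'i \<Rightarrow> nat \<Rightarrow> ('x, 'i) vec \<Rightarrow> ('u, 'i) vec \<Rightarrow> real"
  term_cost :: "'i \<Rightarrow> ('x, 'i) vec \<Rightarrow> real"

definition joint_states ::
  "('i::{finite,linorder}, 'x::euclidean_space, 'u::euclidean_space, 'c::finite, 'd::finite) dynamic_game
    \<Rightarrow> (('x, 'i) vec) set" where
  "joint_states G = {x. \<forall>i. x $ i \<in> state_space G i}"

definition joint_actions ::
  "('i::{finite,linorder}, 'x::euclidean_space, 'u::euclidean_space, 'c::finite, 'd::finite) dynamic_game
    \<Rightarrow> (('u, 'i) vec) set" where
  "joint_actions G = {u. \<forall>i. u $ i \<in> action_space G i}"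

definition joint_dynamics ::
  "('i::{finite,linorder}, 'x::euclidean_space, 'u::euclidean_space, 'c::finite, 'd::finite) dynamic_game
    \<Rightarrow> ('x, 'i) vec \<Rightarrow> ('u, 'i) vec \<Rightarrow> ('x, 'i) vec" where
  "joint_dynamics G x u = (\<chi> i. dynamics G i (x $ i) (u $ i))"

text \<open>
  Continuous differentiability on a set that need not be open: there is a derivative
  relative to the set that depends continuously on the point.
  On open sets this is the usual notion.
\<close>

definition C1_on :: "'a::real_normed_vector set \<Rightarrow> ('a \<Rightarrow> 'b::real_normed_vector) \<Rightarrow> bool" where
  "C1_on S h \<longleftrightarrow>
    (\<exists>D :: 'a \<Rightarrow> 'a \<Rightarrow>\<^sub>L 'b. continuous_on S D \<and>
      (\<forall>z\<in>S. (h has_derivative blinfun_apply (D z)) (at z within S)))"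

text \<open>
  No constraint qualification is imposed on the dynamics and the constraints, so that results
  about such games hold under any choice of one.
\<close>

definition well_formed_game ::
  "('i::{finite,linorder}, 'x::euclidean_space, 'u::euclidean_space, 'c::finite, 'd::finite) dynamic_game
    \<Rightarrow> bool" where
  "well_formed_game G \<longleftrightarrow>
    (\<forall>i. subspace (state_ambient G i) \<and> state_space G i \<subseteq> state_ambient G i) \<and>
    (\<forall>i. subspace (action_ambient G i) \<and> action_space G i \<subseteq> action_ambient G i) \<and>
    (\<forall>i. \<forall>x\<in>state_space G i. \<forall>u\<in>action_space G i. dynamics G i x u \<in> state_ambient G i) \<and>
    init G \<in> joint_states G \<and>
    (\<forall>i. \<forall>\<gamma>\<in>strategies G i. \<forall>k<horizon G. \<gamma> k \<in> action_space G i) \<and>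
    (\<forall>i. \<forall>k<horizon G. C1_on (joint_states G \<times> joint_actions G) (\<lambda>(x, u). stage_cost G i k x u)) \<and>
    (\<forall>i. C1_on (joint_states G) (term_cost G i)) \<and>
    C1_on (joint_states G \<times> joint_actions G) (\<lambda>(x, u). joint_dynamics G x u) \<and>
    C1_on (joint_states G \<times> joint_actions G) (\<lambda>(x, u). constr G x u) \<and>
    C1_on (joint_states G) (term_constr G)"

text \<open>
  The feasible sets \<open>C_k\<close>, which coincide for all \<open>k < horizon\<close>, and \<open>C_T\<close>. Consistency of a
  pair with the dynamics means that its successor is again a state of the game.
\<close>

definition feasible_pairs ::
  "('i::{finite,linorder}, 'x::euclidean_space, 'u::euclidean_space, 'c::finite, 'd::finite) dynamic_game
    \<Rightarrow> (('x, 'i) vec \<times> ('u, 'i) vec) set" where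
  "feasible_pairs G =
    {(x, u). x \<in> joint_states G \<and> u \<in> joint_actions G \<and>
      joint_dynamics G x u \<in> joint_states G \<and> (\<forall>a. constr G x u $ a \<le> 0)}"

definition feasible_terminal ::
  "('i::{finite,linorder}, 'x::euclidean_space, 'u::euclidean_space, 'c::finite, 'd::finite) dynamic_game
    \<Rightarrow> (('x, 'i) vec) set" where
  "feasible_terminal G = {x \<in> joint_states G. \<forall>a. term_constr G x $ a \<le> 0}"

text \<open>
  As the initial state is fixed, an open-loop strategy of an agent is its action sequence;
  only the actions at times before the horizon matter.
\<close>

definition action_traj :: "('i::finite \<Rightarrow> nat \<Rightarrow> 'u) \<Rightarrow> nat \<Rightarrow> ('u, 'i) vec" where
  "action_traj \<gamma> k = (\<chi> i. \<gamma> i k)"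

primrec state_traj ::
  "('i::{finite,linorder}, 'x::euclidean_space, 'u::euclidean_space, 'c::finite, 'd::finite) dynamic_game
    \<Rightarrow> ('i \<Rightarrow> nat \<Rightarrow> 'u) \<Rightarrow> nat \<Rightarrow> ('x, 'i) vec" where
  "state_traj G \<gamma> 0 = init G"
| "state_traj G \<gamma> (Suc k) = joint_dynamics G (state_traj G \<gamma> k) (action_traj \<gamma> k)"

definition feasible ::
  "('i::{finite,linorder}, 'x::euclidean_space, 'u::euclidean_space, 'c::finite, 'd::finite) dynamic_game
    \<Rightarrow> ('i \<Rightarrow> nat \<Rightarrow> 'u) \<Rightarrow> bool" where
  "feasible G \<gamma> \<longleftrightarrow>
    (\<forall>k<horizon G. (state_traj G \<gamma> k, action_traj \<gamma> k) \<in> feasible_pairs G) \<and>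
    state_traj G \<gamma> (horizon G) \<in> feasible_terminal G"

definition total_cost ::
  "('i::{finite,linorder}, 'x::euclidean_space, 'u::euclidean_space, 'c::finite, 'd::finite) dynamic_game
    \<Rightarrow> 'i \<Rightarrow> (nat \<Rightarrow> ('x, 'i) vec) \<Rightarrow> (nat \<Rightarrow> ('u, 'i) vec) \<Rightarrow> real" where
  "total_cost G i x u =
    term_cost G i (x (horizon G)) + (\<Sum>k<horizon G. stage_cost G i k (x k) (u k))"

text \<open>
  The weights enter stage by stage, so a potential functional
  \<open>P(x,u) = L\<^sub>T x\<^sub>T + (\<Sum>k<T. L k x\<^sub>k u\<^sub>k)\<close> is represented by its stage terms \<open>L\<close> and its
  terminal term \<open>L\<^sub>T\<close>. The joint strategy \<open>\<gamma>(i := \<nu>)\<close> is the unilateral deviation of agent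
  \<open>i\<close> from \<open>\<gamma>\<close> to \<open>\<nu>\<close>.
\<close>

definition is_weighted_potential ::
  "('i::{finite,linorder}, 'x::euclidean_space, 'u::euclidean_space, 'c::finite, 'd::finite) dynamic_game
    \<Rightarrow> ('i \<Rightarrow> nat \<Rightarrow> real) \<Rightarrow> (nat \<Rightarrow> ('x, 'i) vec \<Rightarrow> ('u, 'i) vec \<Rightarrow> real) \<Rightarrow> (('x, 'i) vec \<Rightarrow> real) \<Rightarrow> bool" where
  "is_weighted_potential G w L L\<^sub>T \<longleftrightarrow>
    (\<forall>i \<gamma> \<nu>. (\<forall>j. \<gamma> j \<in> strategies G j) \<longrightarrow> \<nu> \<in> strategies G i \<longrightarrow>
      feasible G \<gamma> \<longrightarrow> feasible G (\<gamma>(i := \<nu>)) \<longrightarrow>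
      (let x = state_traj G \<gamma>; u = action_traj \<gamma>;
           x' = state_traj G (\<gamma>(i := \<nu>)); u' = action_traj (\<gamma>(i := \<nu>));
           T = horizon G
       in total_cost G i x u - total_cost G i x' u' =
            w i T * (L\<^sub>T (x T) - L\<^sub>T (x' T)) +
            (\<Sum>k<T. w i k * (L k (x k) (u k) - L k (x' k) (u' k)))))"

definition WCPDG ::
  "('i::{finite,linorder}, 'x::euclidean_space, 'u::euclidean_space, 'c::finite, 'd::finite) dynamic_game
    \<Rightarrow> ('i \<Rightarrow> nat \<Rightarrow> real) \<Rightarrow> bool" where
  "WCPDG G w \<longleftrightarrow>
    (\<forall>i. \<forall>k\<le>horizon G. 0 < w i k) \<and> (\<exists>L L\<^sub>T. is_weighted_potential G w L L\<^sub>T)"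

end

theory Submission
  imports Defs
begin

text \<open>
  A unilateral deviation of agent \<open>i\<close> leaves the trajectories of all other agents unchanged,
  because the dynamics are separate. Hence in the stage potential only the terms that involve
  \<open>i\<close> change, and by symmetry these are \<open>c\<^sup>i L\<^sup>i\<^sup>i\<close> and \<open>c\<^sup>i c\<^sup>j L\<^sup>i\<^sup>j\<close> for \<open>j \<noteq> i\<close>: exactly
  \<open>c\<^sup>i\<close> times the stage cost of \<open>i\<close>. At time \<open>0\<close>, where no symmetry is assumed, the state is
  fixed and the coupling terms do not change at all.
\<close>

text \<open>The double sum lists every pair of agents once, smaller agent first. The position of
  \<open>i\<close> in the order decides on which side it appears: pairs with \<open>l > i\<close>
  give \<open>D i l\<close> directly, pairs with \<open>j < i\<close> give \<open>D j i\<close>,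
  which \<open>sym\<close> turns into \<open>D i j\<close>. Together the two ranges cover all agents
  but \<open>i\<close>.\<close>

lemma sum_pairs_through:
  fixes D :: "'i::{finite,linorder} \<Rightarrow> 'i \<Rightarrow> 'a::comm_monoid_add"
  assumes sym: "\<And>j. j \<noteq> i \<Longrightarrow> D j i = D i j"
    and zero: "\<And>j l. j \<noteq> i \<Longrightarrow> l \<noteq> i \<Longrightarrow> j \<noteq> l \<Longrightarrow> D j l = 0"
  shows "(\<Sum>j\<in>UNIV. \<Sum>l\<in>{j<..}. D j l) = (\<Sum>j\<in>UNIV - {i}. D i j)"
proof -
  \<comment> \<open>Only the term at \<open>l = i\<close> can survive, and it lies in the range
    \<open>{j<..}\<close> exactly when \<open>j < i\<close>.\<close>
  have inner: "(\<Sum>l\<in>{j<..}. D j l) = (if j < i then D i j else 0)" if "j \<noteq> i" for j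
  proof -
    have "(\<Sum>l\<in>{j<..}. D j l) = (\<Sum>l\<in>{j<..}. if l = i then D i j else 0)"
      using that by (intro sum.cong) (auto simp: sym zero)
    then show ?thesis by simp
  qed
  have "(\<Sum>j\<in>UNIV. \<Sum>l\<in>{j<..}. D j l)
      = (\<Sum>l\<in>{i<..}. D i l) + (\<Sum>j\<in>UNIV - {i}. \<Sum>l\<in>{j<..}. D j l)"
    by (simp add: sum.remove[of UNIV i])
  also have "(\<Sum>j\<in>UNIV - {i}. \<Sum>l\<in>{j<..}. D j l) = (\<Sum>j\<in>UNIV - {i}. if j < i then D i j else 0)"
    by (simp add: inner)
  also have "\<dots> = (\<Sum>j\<in>{..<i}. D i j)"
    by (rule sum.mono_neutral_cong_right) auto
  also have "(\<Sum>l\<in>{i<..}. D i l) + \<dots> = (\<Sum>j\<in>{i<..} \<union> {..<i}. D i j)"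
    by (rule sum.union_disjoint[symmetric]) auto
  also have "{i<..} \<union> {..<i} = UNIV - {i}" by auto
  finally show ?thesis .
qed

text \<open>Serves stage and terminal costs alike: \<open>e\<close> holds the coefficients,
  \<open>a\<close> and \<open>b\<close> the own and coupling costs along one trajectory,
  \<open>a'\<close> and \<open>b'\<close> those after agent \<open>i\<close> deviates. Symmetry is
  asked of the change \<open>b - b'\<close> instead of \<open>b\<close> itself, a form that also
  covers time \<open>0\<close>.\<close>

lemma weighted_cost_difference:
  fixes e a a' :: "'i::{finite,linorder} \<Rightarrow> 'b::field" and b b' :: "'i \<Rightarrow> 'i \<Rightarrow> 'b"
  assumes e: "e i \<noteq> 0"
    and a: "\<And>j. j \<noteq> i \<Longrightarrow> a j = a' j"
    and b: "\<And>j l. j \<noteq> i \<Longrightarrow> l \<noteq> i \<Longrightarrow> b j l = b' j l"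
    and sym: "\<And>j. j \<noteq> i \<Longrightarrow> b j i - b' j i = b i j - b' i j"
  shows "(a i + (\<Sum>j\<in>UNIV - {i}. e j * b i j)) - (a' i + (\<Sum>j\<in>UNIV - {i}. e j * b' i j)) =
    1 / e i * (((\<Sum>j\<in>UNIV. e j * a j) + (\<Sum>j\<in>UNIV. \<Sum>l\<in>{j<..}. e j * e l * b j l)) -
      ((\<Sum>j\<in>UNIV. e j * a' j) + (\<Sum>j\<in>UNIV. \<Sum>l\<in>{j<..}. e j * e l * b' j l)))"
proof -
  \<comment> \<open>The factor \<open>e j * e l\<close> is symmetric, so \<open>D\<close> inherits
    the symmetry of the change in \<open>b\<close>, and every \<open>D i j\<close> contains the
    factor \<open>e i\<close>.\<close>
  define D where "D j l = e j * e l * (b j l - b' j l)" for j l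
  have own: "(\<Sum>j\<in>UNIV. e j * a j) - (\<Sum>j\<in>UNIV. e j * a' j) = e i * (a i - a' i)"
    by (simp add: sum.remove[of UNIV i] a algebra_simps)
  have "(\<Sum>j\<in>UNIV. \<Sum>l\<in>{j<..}. e j * e l * b j l) - (\<Sum>j\<in>UNIV. \<Sum>l\<in>{j<..}. e j * e l * b' j l)
      = (\<Sum>j\<in>UNIV. \<Sum>l\<in>{j<..}. D j l)"
    by (simp add: D_def sum_subtractf right_diff_distrib)
  also have "\<dots> = (\<Sum>j\<in>UNIV - {i}. D i j)"
    by (rule sum_pairs_through) (simp_all add: D_def b sym)
  also have "\<dots> = e i * ((\<Sum>j\<in>UNIV - {i}. e j * b i j) - (\<Sum>j\<in>UNIV - {i}. e j * b' i j))"
    by (simp add: D_def sum_distrib_left sum_subtractf right_diff_distrib mult.assoc)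
  finally have coupling: "(\<Sum>j\<in>UNIV. \<Sum>l\<in>{j<..}. e j * e l * b j l) -
      (\<Sum>j\<in>UNIV. \<Sum>l\<in>{j<..}. e j * e l * b' j l) =
      e i * ((\<Sum>j\<in>UNIV - {i}. e j * b i j) - (\<Sum>j\<in>UNIV - {i}. e j * b' i j))" .
  \<comment> \<open>Both parts of the potential change by \<open>e i\<close> times the matching part
    of the cost; the letters let the sums be treated as atoms.\<close>
  have cancel: "p + r - (q + s) = 1 / e i * ((P + R) - (Q + S))"
    if "P - Q = e i * (p - q)" "R - S = e i * (r - s)" for p q r s P Q R S
  proof -
    have "(P + R) - (Q + S) = e i * (p + r - (q + s))"
      using that by (simp add: algebra_simps)
    then show ?thesis using e by simp
  qed
  show ?thesis by (rule cancel[OF own coupling])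
qed

lemma action_traj_deviation:
  "j \<noteq> i \<Longrightarrow> action_traj (\<gamma>(i := \<nu>)) k $ j = action_traj \<gamma> k $ j"
  by (simp add: action_traj_def)

lemma state_traj_deviation:
  "j \<noteq> i \<Longrightarrow> state_traj G (\<gamma>(i := \<nu>)) k $ j = state_traj G \<gamma> k $ j"
  by (induction k) (simp_all add: joint_dynamics_def action_traj_deviation)

text \<open>The cost formulas and symmetries are assumed only on the state and action spaces, and
  feasibility puts a trajectory there. The last state comes from the terminal set, all earlier ones
  from the feasible pairs.\<close>

lemma feasible_memberships:
  assumes "feasible G \<gamma>"
  shows "k \<le> horizon G \<Longrightarrow> state_traj G \<gamma> k \<in> joint_states G"
    and "k < horizon G \<Longrightarrow> action_traj \<gamma> k \<in> joint_actions G"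
  using assms
  by (auto simp: feasible_def feasible_pairs_def feasible_terminal_def le_less)

theorem lemma5:
  fixes G :: "('i::{finite,linorder}, 'x::euclidean_space, 'u::euclidean_space, 'c::finite, 'd::finite) dynamic_game"
    and Lii :: "'i \<Rightarrow> nat \<Rightarrow> 'x \<Rightarrow> 'u \<Rightarrow> real"
    and LiiT :: "'i \<Rightarrow> 'x \<Rightarrow> real"
    and Lij :: "'i \<Rightarrow> 'i \<Rightarrow> nat \<Rightarrow> 'x \<Rightarrow> 'x \<Rightarrow> real"
    and c :: "'i \<Rightarrow> 'i \<Rightarrow> nat \<Rightarrow> real"
    and c' :: "'i \<Rightarrow> nat \<Rightarrow> real"
    and T :: nat
  assumes game: "well_formed_game G"
    and T: "T = horizon G"
    and stage: "\<And>i k x u. k < T \<Longrightarrow> x \<in> joint_states G \<Longrightarrow> u \<in> joint_actions G \<Longrightarrow>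
        stage_cost G i k x u =
          Lii i k (x $ i) (u $ i) + (\<Sum>j\<in>UNIV - {i}. c i j k * Lij i j k (x $ i) (x $ j))"
    and terminal: "\<And>i x. x \<in> joint_states G \<Longrightarrow>
        term_cost G i x =
          LiiT i (x $ i) + (\<Sum>j\<in>UNIV - {i}. c i j T * Lij i j T (x $ i) (x $ j))"
    and c_pos: "\<And>i j k. k \<le> T \<Longrightarrow> 0 < c i j k"
    and sym_stage: "\<And>i j k y z. i \<noteq> j \<Longrightarrow> 1 \<le> k \<Longrightarrow> k < T \<Longrightarrow>
        y \<in> state_space G i \<Longrightarrow> z \<in> state_space G j \<Longrightarrow> Lij i j k y z = Lij j i k z y"
    and sym_terminal: "\<And>i j y z. i \<noteq> j \<Longrightarrow>
        y \<in> state_space G i \<Longrightarrow> z \<in> state_space G j \<Longrightarrow> Lij i j T y z = Lij j i T z y"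
    and c_indep: "\<And>i j k. k \<le> T \<Longrightarrow> i \<noteq> j \<Longrightarrow> c i j k = c' j k"
    and c'_pos: "\<And>j k. k \<le> T \<Longrightarrow> 0 < c' j k"
  shows "WCPDG G (\<lambda>i k. 1 / c' i k) \<and>
    is_weighted_potential G (\<lambda>i k. 1 / c' i k)
      (\<lambda>k x u. (\<Sum>i\<in>UNIV. c' i k * Lii i k (x $ i) (u $ i)) +
        (\<Sum>i\<in>UNIV. \<Sum>j\<in>{i<..}. c' i k * c' j k * Lij i j k (x $ i) (x $ j)))
      (\<lambda>x. (\<Sum>i\<in>UNIV. c' i T * LiiT i (x $ i)) +
        (\<Sum>i\<in>UNIV. \<Sum>j\<in>{i<..}. c' i T * c' j T * Lij i j T (x $ i) (x $ j)))"
proof -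
  let ?L = "\<lambda>k x u. (\<Sum>i\<in>UNIV. c' i k * Lii i k (x $ i) (u $ i)) +
        (\<Sum>i\<in>UNIV. \<Sum>j\<in>{i<..}. c' i k * c' j k * Lij i j k (x $ i) (x $ j))"
  let ?LT = "\<lambda>x. (\<Sum>i\<in>UNIV. c' i T * LiiT i (x $ i)) +
        (\<Sum>i\<in>UNIV. \<Sum>j\<in>{i<..}. c' i T * c' j T * Lij i j T (x $ i) (x $ j))"
  have "is_weighted_potential G (\<lambda>i k. 1 / c' i k) ?L ?LT"
    unfolding is_weighted_potential_def Let_def
  proof (intro allI impI)
    fix i \<gamma> \<nu>
    assume feas: "feasible G \<gamma>" and feas': "feasible G (\<gamma>(i := \<nu>))"
    let ?x = "state_traj G \<gamma>" and ?u = "action_traj \<gamma>"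
    let ?x' = "state_traj G (\<gamma>(i := \<nu>))" and ?u' = "action_traj (\<gamma>(i := \<nu>))"
    have c'_nz: "c' i k \<noteq> 0" if "k \<le> T" for k
      using c'_pos[OF that, of i] by simp
    have states: "?x k $ j \<in> state_space G j" "?x' k $ j \<in> state_space G j" if "k \<le> T" for j k
      using that T feasible_memberships(1)[OF feas, of k] feasible_memberships(1)[OF feas', of k]
      by (simp_all add: joint_states_def)
    \<comment> \<open>At \<open>k = 0\<close> both trajectories are at \<open>init G\<close>, so
      both sides vanish. At later times the symmetry is applied along each trajectory
      separately.\<close>
    have coupling_diff: "Lij j i k (?x k $ j) (?x k $ i) - Lij j i k (?x' k $ j) (?x' k $ i) =
        Lij i j k (?x k $ i) (?x k $ j) - Lij i j k (?x' k $ i) (?x' k $ j)"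
      if "k \<le> T" "j \<noteq> i" for j k
    proof -
      consider "k = 0" | "k = T" | "1 \<le> k" "k < T" using \<open>k \<le> T\<close> by linarith
      then show ?thesis
      proof cases
        case 1
        then show ?thesis by simp
      next
        case 2
        then show ?thesis
          using sym_terminal[OF \<open>j \<noteq> i\<close>, of "?x T $ j" "?x T $ i"]
            sym_terminal[OF \<open>j \<noteq> i\<close>, of "?x' T $ j" "?x' T $ i"] states[of T]
          by simp
      next
        case 3
        then show ?thesis
          using sym_stage[OF \<open>j \<noteq> i\<close> 3, of "?x k $ j" "?x k $ i"]
            sym_stage[OF \<open>j \<noteq> i\<close> 3, of "?x' k $ j" "?x' k $ i"] states[of k]
          by simp
      qed
    qed
    \<comment> \<open>The coefficient must depend on \<open>j\<close> alone: \<open>c' j k\<close>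
      is what the product \<open>c' i k * c' j k\<close> in the potential leaves after division by
      \<open>c' i k\<close>.\<close>
    have stage': "stage_cost G i k x u =
        Lii i k (x $ i) (u $ i) + (\<Sum>j\<in>UNIV - {i}. c' j k * Lij i j k (x $ i) (x $ j))"
      if "k < T" "x \<in> joint_states G" "u \<in> joint_actions G" for k x u
      using that by (simp add: stage c_indep)
    have terminal': "term_cost G i x =
        LiiT i (x $ i) + (\<Sum>j\<in>UNIV - {i}. c' j T * Lij i j T (x $ i) (x $ j))"
      if "x \<in> joint_states G" for x
      using that by (simp add: terminal c_indep)
    have stage_diff: "stage_cost G i k (?x k) (?u k) - stage_cost G i k (?x' k) (?u' k) =
        1 / c' i k * (?L k (?x k) (?u k) - ?L k (?x' k) (?u' k))" if "k < T" for k
    proof -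
      have mem: "?x k \<in> joint_states G" "?u k \<in> joint_actions G"
        "?x' k \<in> joint_states G" "?u' k \<in> joint_actions G"
        using that T feasible_memberships[OF feas, of k] feasible_memberships[OF feas', of k]
        by simp_all
      \<comment> \<open>The conditions on agents other than \<open>i\<close> hold because their
        components agree along both trajectories.\<close>
      show ?thesis
        unfolding stage'[OF that mem(1,2)] stage'[OF that mem(3,4)]
        using that
        by (intro weighted_cost_difference[where e = "\<lambda>j. c' j k"
              and a = "\<lambda>j. Lii j k (?x k $ j) (?u k $ j)"
              and a' = "\<lambda>j. Lii j k (?x' k $ j) (?u' k $ j)"
              and b = "\<lambda>j l. Lij j l k (?x k $ j) (?x k $ l)"
              and b' = "\<lambda>j l. Lij j l k (?x' k $ j) (?x' k $ l)"] c'_nz coupling_diff)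
          (simp_all add: state_traj_deviation action_traj_deviation)
    qed
    have terminal_diff: "term_cost G i (?x T) - term_cost G i (?x' T) =
        1 / c' i T * (?LT (?x T) - ?LT (?x' T))"
    proof -
      have mem: "?x T \<in> joint_states G" "?x' T \<in> joint_states G"
        using T feasible_memberships(1)[OF feas, of T] feasible_memberships(1)[OF feas', of T]
        by simp_all
      show ?thesis
        unfolding terminal'[OF mem(1)] terminal'[OF mem(2)]
        by (intro weighted_cost_difference[where e = "\<lambda>j. c' j T"
              and a = "\<lambda>j. LiiT j (?x T $ j)"
              and a' = "\<lambda>j. LiiT j (?x' T $ j)"
              and b = "\<lambda>j l. Lij j l T (?x T $ j) (?x T $ l)"
              and b' = "\<lambda>j l. Lij j l T (?x' T $ j) (?x' T $ l)"] c'_nz coupling_diff)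
          (simp_all add: state_traj_deviation)
    qed
    \<comment> \<open>The weights vary with time, so the costs are compared term by term.\<close>
    have "total_cost G i ?x ?u - total_cost G i ?x' ?u' =
        (term_cost G i (?x T) - term_cost G i (?x' T)) +
        (\<Sum>k<T. stage_cost G i k (?x k) (?u k) - stage_cost G i k (?x' k) (?u' k))"
      by (simp add: total_cost_def T sum_subtractf)
    also have "\<dots> = 1 / c' i T * (?LT (?x T) - ?LT (?x' T)) +
        (\<Sum>k<T. 1 / c' i k * (?L k (?x k) (?u k) - ?L k (?x' k) (?u' k)))"
      by (intro arg_cong2[where f = "(+)"] terminal_diff sum.cong refl stage_diff) simp
    finally show "total_cost G i ?x ?u - total_cost G i ?x' ?u' =
        1 / c' i (horizon G) * (?LT (?x (horizon G)) - ?LT (?x' (horizon G))) +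
        (\<Sum>k<horizon G. 1 / c' i k * (?L k (?x k) (?u k) - ?L k (?x' k) (?u' k)))"
      unfolding T .
  qed
  moreover have "\<forall>i. \<forall>k\<le>horizon G. 0 < 1 / c' i k"
    using c'_pos T by simp
  ultimately show ?thesis
    unfolding WCPDG_def by blast
qed

end
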